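(* Let $n\ge 2$, let $F:\mathbb{R}^n\to\mathbb{R}^n$ be differentiable with Jacobian $J(x)$, and let $x^*$ satisfy $F(x^* )=0$. Suppose there is a constant $M\ge 0$ such that $\|J(x)-J(x^* )\|\le M\|x-x^*\|$ for all $x\in\mathbb{R}^n$, and suppose $J_*:=J(x^* )$ is nonsingular; put $c=\|J_*^{-1}\|$. Let $(x_k,B_k)_{k\ge0}$ be generated by the greedy Broyden's method (defined in the context) from $x_0\in\mathbb{R}^n$, $B_0\in\mathbb{R}^{n\times n}$, and assume the iteration is well defined, i.e. $B_k$ is nonsingular for all $k$. If $$48\sqrt{n}\,cM\|x_0-x^*\|+c\|B_0-J(x_0)\|\le\frac13,$$ then $$\|x_k-x^*\|\le e^k\Big(1-\frac1n\Big)^{k(k-1)/4}\|x_0-x^*\|\quad\text{for all }k\ge 1,$$ and $$\|B_k-J_*\|_F\le 2c^{-1}e\Big(1-\frac1n\Big)^{k/2}\quad\text{for all }k\ge 4n+3.$$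
   Context: $\|\cdot\|$ is the Euclidean norm for vectors and the spectral (induced 2-) norm for matrices; $\|\cdot\|_F$ is the Frobenius norm; $e_1,\dots,e_n$ is the standard basis of $\mathbb{R}^n$; the scalar $e$ is Euler's number. Greedy Broyden's method: given $x_0$ and $B_0$, for $k=0,1,2,\dots$ set $$x_{k+1}=x_k-B_k^{-1}F(x_k),\qquad u_k\in\arg\max_{u\in\{e_1,\dots,e_n\}}\|B_ku-J(x_{k+1})u\|,$$ $$B_{k+1}=B_k+\frac{(J(x_{k+1})u_k-B_ku_k)u_k^\top}{u_k^\top u_k}.$$ *)

theory Defs
  imports "HOL-Analysis.Analysis"
begin

text \<open>The library's \<open>norm\<close> on the type of matrices is the Frobenius norm, so the spectral
  (operator) norm has to be written through \<open>onorm\<close>.\<close>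

definition spectral_norm :: "real^'n^'m \<Rightarrow> real" where
  "spectral_norm A = onorm (\<lambda>v. A *v v)"

definition frobenius_norm :: "real^'n^'m \<Rightarrow> real" where
  "frobenius_norm A = sqrt (\<Sum>i\<in>UNIV. \<Sum>j\<in>UNIV. (A $ i $ j)\<^sup>2)"

lemma frobenius_norm_eq_norm: "frobenius_norm A = norm A"
  by (simp add: frobenius_norm_def norm_vec_def L2_set_def sum_nonneg)

definition outer_product :: "real^'m \<Rightarrow> real^'n \<Rightarrow> real^'n^'m" where
  "outer_product v w = (\<chi> i j. v $ i * w $ j)"

text \<open>Ties in the greedy choice of \<open>u k\<close> may be broken arbitrarily, hence a
  predicate on the sequences instead of recursive functions. The inverse is
  meaningful only for nonsingular \<open>B k\<close>; well-definedness is a separate assumption.\<close>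

definition greedy_broyden ::
  "(real^'n \<Rightarrow> real^'n) \<Rightarrow> (real^'n \<Rightarrow> real^'n^'n) \<Rightarrow>
   (nat \<Rightarrow> real^'n) \<Rightarrow> (nat \<Rightarrow> real^'n^'n) \<Rightarrow> (nat \<Rightarrow> real^'n) \<Rightarrow> bool" where
  "greedy_broyden F J x B u \<longleftrightarrow>
     (\<forall>k. x (Suc k) = x k - matrix_inv (B k) *v F (x k)
        \<and> is_arg_max (\<lambda>w. norm (B k *v w - J (x (Suc k)) *v w))
             (\<lambda>w. w \<in> range (\<lambda>i. axis i 1)) (u k)
        \<and> B (Suc k) = B k + (1 / (u k \<bullet> u k)) *\<^sub>R
             outer_product (J (x (Suc k)) *v u k - B k *v u k) (u k))"

end

theory Submission
  imports Defs
begin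

text \<open>
  Scaled by \<open>c\<close>, the quantities to follow are \<open>m k = c * M * \<parallel>x k - x\<^sub>*\<parallel>\<close>, which bounds the error of
  \<open>J (x k)\<close> against \<open>J\<^sub>*\<close>, and the spectral and Frobenius norms \<open>s k\<close> and \<open>t k\<close> of
  \<open>E k = B k - J (x k)\<close>. A quasi-Newton step multiplies the error by at most
  \<open>(s k + 2 * m k) / (1 - s k - m k)\<close> (lemma \<open>quasi_newton_step\<close>), and a greedy update replaces the
  worst column of \<open>B k\<close> by the one of the new Jacobian, that is, it zeroes the largest column of the
  error matrix. Zeroing a column does not increase the spectral norm, and zeroing the largest one
  contracts the Frobenius norm by \<open>\<rho> = sqrt (1 - 1 / n)\<close>.

  The first property gives linear convergence with factor \<open>1 / 2\<close>, because the total drift of the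
  Jacobian is a geometric series in \<open>m 0\<close> (lemma \<open>spectral_error_bound\<close>). The second one gives
  \<open>t k \<le> const * \<rho> ^ k\<close> and hence superlinear convergence, but with a constant of order \<open>sqrt n\<close>
  when the initial matrix is only known to be accurate in the spectral norm. The remedy is that
  \<open>n\<close> greedy steps make every column accurate up to the drift of the Jacobian
  (lemma \<open>accurate_columns\<close>), so that \<open>t n\<close> is of order \<open>sqrt n * m 0\<close>, which the hypothesis makes
  small. Contraction from step \<open>n\<close> onwards then yields \<open>t k \<le> \<rho> ^ k / 4\<close>
  (lemma \<open>lyapunov_bound\<close>), as \<open>\<rho> ^ n \<ge> 1 / 4\<close>. For the same reason halving the error in the
  first \<open>n\<close> steps is already within the factor \<open>e * \<rho> ^ k\<close>, and that factor therefore bounds the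
  error reduction of every step (lemma \<open>r_Suc_le\<close>). Multiplying these factors gives the exponent
  \<open>k * (k - 1) / 4\<close>.
\<close>

section \<open>Spectral and Frobenius norms\<close>

lemma norm_mult_vec_le_spectral:
  fixes A :: "real^'n^'m"
  shows "norm (A *v v) \<le> spectral_norm A * norm v"
  unfolding spectral_norm_def by (rule onorm) simp

lemma spectral_norm_nonneg: "0 \<le> spectral_norm (A :: real^'n^'m)"
  unfolding spectral_norm_def by (rule onorm_pos_le) simp

lemma spectral_norm_leI:
  fixes A :: "real^'n^'m"
  assumes "\<And>v. norm (A *v v) \<le> b * norm v"
  shows "spectral_norm A \<le> b"
  unfolding spectral_norm_def using assms by (rule onorm_le)

lemma spectral_norm_triangle:
  fixes A B :: "real^'n^'m"
  shows "spectral_norm (A + B) \<le> spectral_norm A + spectral_norm B"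
proof (rule spectral_norm_leI)
  fix v
  show "norm ((A + B) *v v) \<le> (spectral_norm A + spectral_norm B) * norm v"
    using norm_triangle_ineq[of "A *v v" "B *v v"]
      norm_mult_vec_le_spectral[of A v] norm_mult_vec_le_spectral[of B v]
    by (simp add: matrix_vector_mult_add_rdistrib distrib_right)
qed

lemma spectral_norm_minus_commute:
  fixes A B :: "real^'n^'m"
  shows "spectral_norm (A - B) = spectral_norm (B - A)"
  using onorm_neg[of "\<lambda>v. (A - B) *v v"]
  by (simp add: spectral_norm_def matrix_vector_mult_diff_rdistrib)

lemma norm_matrix_power2_columns:
  fixes A :: "real^'n^'m"
  shows "(norm A)\<^sup>2 = (\<Sum>j\<in>UNIV. (norm (column j A))\<^sup>2)"
proof -
  have "(norm A)\<^sup>2 = (\<Sum>i\<in>UNIV. \<Sum>j\<in>UNIV. (A $ i $ j)\<^sup>2)"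
    by (simp add: norm_vec_def L2_set_def sum_nonneg)
  also have "\<dots> = (\<Sum>j\<in>UNIV. \<Sum>i\<in>UNIV. (A $ i $ j)\<^sup>2)"
    by (rule sum.swap)
  also have "\<dots> = (\<Sum>j\<in>UNIV. (norm (column j A))\<^sup>2)"
    by (simp add: norm_vec_def L2_set_def sum_nonneg column_def)
  finally show ?thesis .
qed

lemma column_add: "column j (A + B) = column j A + column j B"
  by (simp add: column_def vec_eq_iff)

lemma norm_column_le_spectral:
  fixes A :: "real^'n^'m"
  shows "norm (column j A) \<le> spectral_norm A"
  unfolding spectral_norm_def by (rule norm_column_le_onorm)

lemma frobenius_le_columns:
  fixes A :: "real^'n^'m"
  assumes "\<And>j. norm (column j A) \<le> b" and "0 \<le> b"
  shows "norm A \<le> sqrt (real CARD('n)) * b"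
proof -
  have "(norm A)\<^sup>2 \<le> (\<Sum>j\<in>(UNIV::'n set). b\<^sup>2)"
    unfolding norm_matrix_power2_columns by (intro sum_mono power_mono assms) simp
  also have "\<dots> = (sqrt (real CARD('n)) * b)\<^sup>2"
    by (simp add: power_mult_distrib)
  finally show ?thesis
    by (rule power2_le_imp_le) (use assms in simp)
qed

lemma frobenius_le_spectral:
  fixes A :: "real^'n^'m"
  shows "norm A \<le> sqrt (real CARD('n)) * spectral_norm A"
  by (rule frobenius_le_columns) (rule norm_column_le_spectral spectral_norm_nonneg)+

lemma spectral_le_frobenius:
  fixes A :: "real^'n^'m"
  shows "spectral_norm A \<le> norm A"
proof (rule spectral_norm_leI)
  fix v
  have "(norm (A *v v))\<^sup>2 = (\<Sum>i\<in>UNIV. ((A $ i) \<bullet> v)\<^sup>2)"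
    by (simp add: norm_vec_def L2_set_def sum_nonneg matrix_vector_mult_def inner_vec_def)
  also have "\<dots> \<le> (\<Sum>i\<in>UNIV. (norm (A $ i) * norm v)\<^sup>2)"
    by (intro sum_mono) (metis Cauchy_Schwarz_ineq2 abs_ge_zero power2_abs power_mono)
  also have "\<dots> = (norm A * norm v)\<^sup>2"
    by (simp add: norm_vec_def[of A] L2_set_def sum_nonneg power_mult_distrib
        flip: sum_distrib_right)
  finally show "norm (A *v v) \<le> norm A * norm v"
    by (rule power2_le_imp_le) simp
qed

section \<open>Zeroing a column\<close>

text \<open>The arg max runs over basis vectors, and \<open>(B - K) e\<^sub>i\<close> is the \<open>i\<close>-th column of the error; the
  rank-one update along \<open>e\<^sub>i\<close> writes the \<open>i\<close>-th column of \<open>K\<close> into \<open>B\<close> and changes no other.\<close>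

lemma greedy_step_columns:
  fixes B B' K :: "real^'n^'m"
  assumes greedy: "is_arg_max (\<lambda>w. norm (B *v w - K *v w)) (\<lambda>w. w \<in> range (\<lambda>i. axis i 1)) u"
    and update: "B' = B + (1 / (u \<bullet> u)) *\<^sub>R outer_product (K *v u - B *v u) u"
  obtains i where "\<And>j. column j (B' - K) = (if j = i then 0 else column j (B - K))"
    and "\<And>j. norm (column j (B - K)) \<le> norm (column i (B - K))"
proof -
  obtain i where u: "u = axis i 1"
    using greedy by (auto simp: is_arg_max_def)
  have col: "B *v axis j 1 - K *v axis j 1 = column j (B - K)" for j
    by (simp add: matrix_vector_mult_basis column_def vec_eq_iff)
  have "norm (column j (B - K)) \<le> norm (column i (B - K))" for j
    using greedy unfolding is_arg_max_linorder u col[symmetric] by auto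
  moreover have "column j (B' - K) = (if j = i then 0 else column j (B - K))" for j
    by (simp add: update u inner_axis_axis matrix_vector_mult_basis outer_product_def
        column_def vec_eq_iff) (simp add: axis_def)
  ultimately show thesis by (intro that[of i]) simp_all
qed

lemma spectral_norm_zero_column:
  fixes C C' :: "real^'n^'m"
  assumes "\<And>j. column j C' = (if j = i then 0 else column j C)"
  shows "spectral_norm C' \<le> spectral_norm C"
proof (rule spectral_norm_leI)
  fix v :: "real^'n"
  define v' where "v' = (\<chi> j. if j = i then 0 else v $ j)"
  have "C' *v v = C *v v'"
    by (auto simp: matrix_mult_sum assms v'_def intro!: sum.cong)
  also have "norm \<dots> \<le> spectral_norm C * norm v'"
    by (rule norm_mult_vec_le_spectral)
  also have "\<dots> \<le> spectral_norm C * norm v"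
    by (intro mult_left_mono norm_le_componentwise_cart spectral_norm_nonneg) (simp add: v'_def)
  finally show "norm (C' *v v) \<le> spectral_norm C * norm v" .
qed

text \<open>The largest of the \<open>n\<close> squared column norms is at least their mean, so zeroing that column
  removes at least the fraction \<open>1 / n\<close> of the squared Frobenius norm.\<close>

lemma frobenius_zero_largest_column:
  fixes C C' :: "real^'n^'m"
  assumes zero: "\<And>j. column j C' = (if j = i then 0 else column j C)"
    and largest: "\<And>j. norm (column j C) \<le> norm (column i C)"
  shows "norm C' \<le> sqrt (1 - 1 / real CARD('n)) * norm C"
proof -
  have "(norm C)\<^sup>2 \<le> (\<Sum>j\<in>(UNIV::'n set). (norm (column i C))\<^sup>2)"
    unfolding norm_matrix_power2_columns by (intro sum_mono power_mono largest) simp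
  then have mean: "(norm C)\<^sup>2 / real CARD('n) \<le> (norm (column i C))\<^sup>2"
    by (simp add: field_simps)
  have "(norm C')\<^sup>2 = (\<Sum>j\<in>UNIV. if j = i then 0 else (norm (column j C))\<^sup>2)"
    unfolding norm_matrix_power2_columns zero by (intro sum.cong) auto
  also have "\<dots> = (\<Sum>j\<in>UNIV - {i}. (norm (column j C))\<^sup>2)"
    by (simp add: sum.If_cases Compl_eq_Diff_UNIV)
  also have "\<dots> = (norm C)\<^sup>2 - (norm (column i C))\<^sup>2"
    unfolding norm_matrix_power2_columns[of C] by (simp add: sum_diff1)
  also have "\<dots> \<le> (1 - 1 / real CARD('n)) * (norm C)\<^sup>2"
    using mean by (simp add: left_diff_distrib)
  also have "\<dots> = (sqrt (1 - 1 / real CARD('n)) * norm C)\<^sup>2"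
    by (simp add: power_mult_distrib Suc_le_eq)
  finally show ?thesis
    by (rule power2_le_imp_le) (simp add: Suc_le_eq)
qed

section \<open>One quasi-Newton step\<close>

lemma matrix_inv_cancel:
  fixes A :: "real^'n^'n"
  assumes "invertible A"
  shows "A *v (matrix_inv A *v v) = v" and "matrix_inv A *v (A *v v) = v"
proof -
  have "A ** matrix_inv A = mat 1 \<and> matrix_inv A ** A = mat 1"
    using assms unfolding invertible_def matrix_inv_def by (rule someI_ex)
  then show "A *v (matrix_inv A *v v) = v" and "matrix_inv A *v (A *v v) = v"
    by (simp_all add: matrix_vector_mul_assoc)
qed

lemma spectral_norm_inverse_lower_bound:
  fixes A :: "real^'n^'n"
  assumes "invertible A"
  shows "norm v \<le> spectral_norm (matrix_inv A) * norm (A *v v)"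
  using norm_mult_vec_le_spectral[of "matrix_inv A" "A *v v"] assms
  by (simp add: matrix_inv_cancel)

lemma spectral_norm_inverse_pos:
  fixes A :: "real^'n^'n"
  assumes "invertible A"
  shows "0 < spectral_norm (matrix_inv A)"
proof -
  have "norm (axis undefined 1 :: real^'n) = 1" by simp
  then have "spectral_norm (matrix_inv A) \<noteq> 0"
    using spectral_norm_inverse_lower_bound[OF assms, of "axis undefined 1"] by auto
  then show ?thesis
    using spectral_norm_nonneg[of "matrix_inv A"] by linarith
qed

text \<open>The new error \<open>z\<close> satisfies \<open>B z = (B - J\<^sub>*) (y - x\<^sub>*) - (Taylor remainder at x\<^sub>*)\<close>. Writing
  \<open>J\<^sub>* z = B z - (B - J\<^sub>*) z\<close> and inverting \<open>J\<^sub>*\<close> instead of \<open>B\<close> puts the factor \<open>1 - d\<close> on the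
  left, without a perturbation bound for the inverse of \<open>B\<close>.\<close>

lemma quasi_newton_step:
  fixes F :: "real^'n \<Rightarrow> real^'n" and J :: "real^'n \<Rightarrow> real^'n^'n" and B :: "real^'n^'n"
  assumes deriv: "\<And>y. (F has_derivative (\<lambda>h. J y *v h)) (at y)"
    and root: "F xstar = 0"
    and lip: "\<And>y. spectral_norm (J y - J xstar) \<le> M * norm (y - xstar)" and "0 \<le> M"
    and inv: "invertible (J xstar)" and c: "c = spectral_norm (matrix_inv (J xstar))"
    and B: "invertible B"
  defines "d \<equiv> c * spectral_norm (B - J xstar)"
  shows "(1 - d) * norm (y - matrix_inv B *v F y - xstar)
    \<le> (d + c * M * norm (y - xstar)) * norm (y - xstar)"
proof -
  define e where "e = y - xstar"
  define z where "z = y - matrix_inv B *v F y - xstar"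
  define R where "R = F y - F xstar - J xstar *v e"
  have c0: "0 \<le> c"
    unfolding c by (rule spectral_norm_nonneg)
  have "norm R \<le> norm (y - xstar) * (M * norm (y - xstar))"
    unfolding R_def e_def
  proof (rule differentiable_bound_linearization[where f' = "\<lambda>v. (*v) (J v)"
        and S = "cball xstar (norm (y - xstar))"])
    fix t :: real
    assume "t \<in> {0..1}"
    then show "xstar + t *\<^sub>R (y - xstar) \<in> cball xstar (norm (y - xstar))"
      by (simp add: dist_norm mult_left_le_one_le)
  next
    fix v
    assume "v \<in> cball xstar (norm (y - xstar))"
    then have "norm (v - xstar) \<le> norm (y - xstar)"
      by (simp add: dist_norm norm_minus_commute)
    then have "spectral_norm (J v - J xstar) \<le> M * norm (y - xstar)"
      using lip[of v] mult_left_mono[OF _ \<open>0 \<le> M\<close>] order_trans by blast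
    then show "onorm ((*v) (J v) - (*v) (J xstar)) \<le> M * norm (y - xstar)"
      by (simp add: spectral_norm_def matrix_vector_mult_diff_rdistrib fun_diff_def)
  qed (auto intro: has_derivative_at_withinI deriv)
  then have R: "norm R \<le> M * norm e * norm e"
    by (simp add: e_def mult_ac)
  have "B *v z = B *v e - F y"
    using B by (simp add: z_def e_def matrix_vector_mult_diff_distrib matrix_inv_cancel)
  then have "J xstar *v z = (B - J xstar) *v e - R - (B - J xstar) *v z"
    by (simp add: R_def root matrix_vector_mult_diff_rdistrib)
  also have "norm \<dots> \<le> norm ((B - J xstar) *v e) + norm R + norm ((B - J xstar) *v z)"
    by (smt (verit) norm_triangle_ineq4)
  also have "\<dots> \<le> spectral_norm (B - J xstar) * norm e + M * norm e * norm e
      + spectral_norm (B - J xstar) * norm z"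
    by (intro add_mono R norm_mult_vec_le_spectral)
  finally have "c * norm (J xstar *v z) \<le> c * (spectral_norm (B - J xstar) * norm e
      + M * norm e * norm e + spectral_norm (B - J xstar) * norm z)"
    using c0 by (rule mult_left_mono)
  moreover have "norm z \<le> c * norm (J xstar *v z)"
    unfolding c by (rule spectral_norm_inverse_lower_bound[OF inv])
  ultimately show ?thesis
    by (simp add: d_def flip: e_def z_def) (simp add: algebra_simps)
qed

section \<open>The greedy Broyden iteration\<close>

text \<open>This says that the first \<open>n\<close> contractions of the Frobenius error together gain only a bounded
  factor. Bernoulli's inequality for \<open>1 - 1 / n\<close> itself would give the void bound \<open>0\<close>; the square
  root leaves room for \<open>1 - 3 / (4 * n)\<close>.\<close>

lemma sqrt_contraction_power_ge:
  assumes "2 \<le> (n::nat)"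
  shows "1 / 4 \<le> sqrt (1 - 1 / real n) ^ n"
proof -
  have "1 - 3 / (4 * real n) \<le> sqrt (1 - 1 / real n)"
  proof (rule real_le_rsqrt)
    show "(1 - 3 / (4 * real n))\<^sup>2 \<le> 1 - 1 / real n"
      using assms by (simp add: power2_eq_square field_simps)
  qed
  then have "(1 - 3 / (4 * real n)) ^ n \<le> sqrt (1 - 1 / real n) ^ n"
    using assms by (intro power_mono) (simp_all add: field_simps)
  moreover have "1 + real n * (- 3 / (4 * real n)) \<le> (1 + (- 3 / (4 * real n))) ^ n"
    using assms by (intro Bernoulli_inequality) (simp add: field_simps)
  moreover have "1 + real n * (- 3 / (4 * real n)) = 1 / 4"
    using assms by simp
  ultimately show ?thesis
    by simp
qed

text \<open>The contraction factor \<open>rho\<close> is a parameter fixed by an equation because a constant that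
  depends on the type \<open>'n\<close> alone would have to carry a type argument.\<close>

locale greedy_broyden_run =
  fixes F :: "real^'n \<Rightarrow> real^'n"
    and J :: "real^'n \<Rightarrow> real^'n^'n"
    and xstar :: "real^'n"
    and M c :: real
    and x u :: "nat \<Rightarrow> real^'n"
    and B :: "nat \<Rightarrow> real^'n^'n"
    and rho :: real
  assumes rho_def: "rho = sqrt (1 - 1 / real CARD('n))"
    and dim: "2 \<le> CARD('n)"
    and deriv: "\<And>y. (F has_derivative (\<lambda>h. J y *v h)) (at y)"
    and root: "F xstar = 0"
    and M_nonneg: "0 \<le> M"
    and lip: "\<And>y. spectral_norm (J y - J xstar) \<le> M * norm (y - xstar)"
    and inv_Jstar: "invertible (J xstar)"
    and c_def: "c = spectral_norm (matrix_inv (J xstar))"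
    and run: "greedy_broyden F J x B u"
    and inv_B: "\<And>k. invertible (B k)"
    and close: "48 * sqrt (real CARD('n)) * c * M * norm (x 0 - xstar)
           + c * spectral_norm (B 0 - J (x 0)) \<le> 1 / 3"
begin

definition r :: "nat \<Rightarrow> real" where
  "r k = norm (x k - xstar)"

text \<open>Everything is scaled by \<open>c\<close> so that the smallness hypothesis becomes a dimensionless one;
  \<open>m k\<close> bounds the scaled error of \<open>J (x k)\<close> as an approximation of \<open>J xstar\<close>.\<close>

definition m :: "nat \<Rightarrow> real" where
  "m k = c * M * r k"

definition E :: "nat \<Rightarrow> real^'n^'n" where
  "E k = B k - J (x k)"

definition s :: "nat \<Rightarrow> real" where
  "s k = c * spectral_norm (E k)"

definition t :: "nat \<Rightarrow> real" where
  "t k = c * norm (E k)"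

lemma c_pos: "0 < c"
  unfolding c_def by (rule spectral_norm_inverse_pos[OF inv_Jstar])

lemma r_nonneg: "0 \<le> r k"
  by (simp add: r_def)

lemma m_nonneg: "0 \<le> m k"
  using c_pos M_nonneg r_nonneg by (simp add: m_def)

lemma s_nonneg: "0 \<le> s k"
  using c_pos spectral_norm_nonneg[of "E k"] by (simp add: s_def)

lemma s_le_t: "s k \<le> t k"
  using c_pos spectral_le_frobenius[of "E k"] by (simp add: s_def t_def)

lemma sqrt_n_ge_1: "1 \<le> sqrt (real CARD('n))"
  using dim by simp

lemma rho_bounds: "2 / 3 \<le> rho" "rho \<le> 1"
proof -
  have "1 / real CARD('n) \<le> 1 / 2"
    using dim by (simp add: field_simps)
  moreover have "(2 / 3)\<^sup>2 = (4 / 9 :: real)"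
    by (simp add: power2_eq_square)
  ultimately have "(2 / 3)\<^sup>2 \<le> 1 - 1 / real CARD('n)"
    by linarith
  then show "2 / 3 \<le> rho"
    unfolding rho_def by (rule real_le_rsqrt)
  show "rho \<le> 1" by (simp add: rho_def)
qed

lemma initial_bound: "48 * (sqrt (real CARD('n)) * m 0) + s 0 \<le> 1 / 3"
  using close by (simp add: m_def s_def r_def E_def mult_ac)

lemma m0_le: "m 0 \<le> sqrt (real CARD('n)) * m 0"
  using mult_right_mono[OF sqrt_n_ge_1 m_nonneg[of 0]] by simp

lemma jacobian_error: "c * spectral_norm (J (x k) - J xstar) \<le> m k"
  using mult_left_mono[OF lip, of c] c_pos by (simp add: m_def r_def mult_ac)

lemma jacobian_change: "c * spectral_norm (J (x k) - J (x (Suc k))) \<le> m k + m (Suc k)"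
proof -
  have "spectral_norm (J (x k) - J (x (Suc k)))
      \<le> spectral_norm (J (x k) - J xstar) + spectral_norm (J (x (Suc k)) - J xstar)"
    using spectral_norm_triangle[of "J (x k) - J xstar" "J xstar - J (x (Suc k))"]
    by (simp add: spectral_norm_minus_commute[of "J xstar"])
  then have "c * spectral_norm (J (x k) - J (x (Suc k)))
      \<le> c * spectral_norm (J (x k) - J xstar) + c * spectral_norm (J (x (Suc k)) - J xstar)"
    using c_pos by (simp flip: distrib_left)
  then show ?thesis
    using jacobian_error[of k] jacobian_error[of "Suc k"] by linarith
qed

lemma old_error_split: "B k - J (x (Suc k)) = E k + (J (x k) - J (x (Suc k)))"
  by (simp add: E_def)

lemma error_columns:
  obtains i where
    "\<And>j. column j (E (Suc k)) = (if j = i then 0 else column j (B k - J (x (Suc k))))"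
    and "\<And>j. norm (column j (B k - J (x (Suc k)))) \<le> norm (column i (B k - J (x (Suc k))))"
proof -
  note step = run[unfolded greedy_broyden_def, THEN spec, of k, THEN conjunct2]
  show thesis
    by (rule greedy_step_columns[OF step[THEN conjunct1] step[THEN conjunct2]])
      (rule that[unfolded E_def])
qed

lemma s_Suc: "s (Suc k) \<le> s k + m k + m (Suc k)"
proof -
  obtain i where "\<And>j. column j (E (Suc k)) = (if j = i then 0 else column j (B k - J (x (Suc k))))"
    by (rule error_columns[of k]) (rule that)
  then have "spectral_norm (E (Suc k)) \<le> spectral_norm (B k - J (x (Suc k)))"
    by (rule spectral_norm_zero_column)
  also have "\<dots> \<le> spectral_norm (E k) + spectral_norm (J (x k) - J (x (Suc k)))"
    unfolding old_error_split by (rule spectral_norm_triangle)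
  finally have "s (Suc k) \<le> s k + c * spectral_norm (J (x k) - J (x (Suc k)))"
    using c_pos by (simp add: s_def flip: distrib_left)
  then show ?thesis
    using jacobian_change[of k] by linarith
qed

lemma t_Suc: "t (Suc k) \<le> rho * (t k + sqrt (real CARD('n)) * (m k + m (Suc k)))"
proof -
  obtain i where "\<And>j. column j (E (Suc k)) = (if j = i then 0 else column j (B k - J (x (Suc k))))"
    and "\<And>j. norm (column j (B k - J (x (Suc k)))) \<le> norm (column i (B k - J (x (Suc k))))"
    by (rule error_columns[of k]) (rule that)
  then have "norm (E (Suc k)) \<le> rho * norm (B k - J (x (Suc k)))"
    unfolding rho_def
    by (rule frobenius_zero_largest_column)
  then have "c * norm (E (Suc k)) \<le> c * (rho * norm (B k - J (x (Suc k))))"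
    using c_pos by simp
  then have "t (Suc k) \<le> rho * (c * norm (B k - J (x (Suc k))))"
    by (simp add: t_def mult.left_commute)
  moreover have "c * norm (B k - J (x (Suc k))) \<le> t k + sqrt (real CARD('n)) * (m k + m (Suc k))"
  proof -
    have "norm (B k - J (x (Suc k))) \<le> norm (E k) + norm (J (x k) - J (x (Suc k)))"
      unfolding old_error_split by (rule norm_triangle_ineq)
    also have "\<dots> \<le> norm (E k) + sqrt (real CARD('n)) * spectral_norm (J (x k) - J (x (Suc k)))"
      by (intro add_left_mono frobenius_le_spectral)
    finally have "c * norm (B k - J (x (Suc k)))
        \<le> c * (norm (E k) + sqrt (real CARD('n)) * spectral_norm (J (x k) - J (x (Suc k))))"
      using c_pos by simp
    then have "c * norm (B k - J (x (Suc k)))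
        \<le> t k + sqrt (real CARD('n)) * (c * spectral_norm (J (x k) - J (x (Suc k))))"
      by (simp add: t_def distrib_left mult.left_commute)
    moreover have "sqrt (real CARD('n)) * (c * spectral_norm (J (x k) - J (x (Suc k))))
        \<le> sqrt (real CARD('n)) * (m k + m (Suc k))"
      by (intro mult_left_mono jacobian_change) simp
    ultimately show ?thesis by linarith
  qed
  then have "rho * (c * norm (B k - J (x (Suc k))))
      \<le> rho * (t k + sqrt (real CARD('n)) * (m k + m (Suc k)))"
    by (rule mult_left_mono) (use rho_bounds(1) in linarith)
  ultimately show ?thesis by linarith
qed

lemma star_error_split: "B k - J xstar = E k + (J (x k) - J xstar)"
  by (simp add: E_def)

lemma r_Suc: "(1 - s k - m k) * r (Suc k) \<le> (s k + 2 * m k) * r k"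
proof -
  define d where "d = c * spectral_norm (B k - J xstar)"
  have "spectral_norm (B k - J xstar) \<le> spectral_norm (E k) + spectral_norm (J (x k) - J xstar)"
    unfolding star_error_split by (rule spectral_norm_triangle)
  then have "d \<le> s k + c * spectral_norm (J (x k) - J xstar)"
    using c_pos by (simp add: d_def s_def flip: distrib_left)
  then have d: "d \<le> s k + m k"
    using jacobian_error[of k] by linarith
  have "x (Suc k) = x k - matrix_inv (B k) *v F (x k)"
    by (rule run[unfolded greedy_broyden_def, THEN spec, THEN conjunct1])
  then have "(1 - d) * r (Suc k) \<le> (d + m k) * r k"
    using quasi_newton_step[OF deriv root lip M_nonneg inv_Jstar c_def inv_B[of k], of "x k"]
    unfolding d_def r_def m_def by (simp only:)
  moreover have "(1 - s k - m k) * r (Suc k) \<le> (1 - d) * r (Suc k)"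
    using d by (intro mult_right_mono r_nonneg) linarith
  moreover have "(d + m k) * r k \<le> (s k + 2 * m k) * r k"
    using d by (intro mult_right_mono r_nonneg) linarith
  ultimately show ?thesis by linarith
qed

subsection \<open>Linear convergence\<close>

text \<open>While the \<open>r k\<close> halve, \<open>s k + 3 * m k\<close> cannot grow: a step adds at most
  \<open>m k + m (Suc k)\<close> to \<open>s k\<close>, which is \<open>3 / 2 * m k\<close> at most, and \<open>3 * m k\<close> loses as much. In
  turn, \<open>s k + 3 * m k \<le> 1 / 3\<close> forces halving in the next step.\<close>

lemma halving_if:
  assumes "s k + 3 * m k \<le> 1 / 3"
  shows "r (Suc k) \<le> r k / 2"
proof -
  have "2 / 3 * r (Suc k) \<le> (1 - s k - m k) * r (Suc k)"
    using assms m_nonneg[of k] by (intro mult_right_mono r_nonneg) linarith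
  also have "\<dots> \<le> (s k + 2 * m k) * r k"
    by (rule r_Suc)
  also have "\<dots> \<le> 1 / 3 * r k"
    using assms m_nonneg[of k] by (intro mult_right_mono r_nonneg) linarith
  finally show ?thesis by simp
qed

lemma m_halving_if:
  assumes "r (Suc k) \<le> r k / 2"
  shows "m (Suc k) \<le> m k / 2"
  using mult_left_mono[OF assms, of "c * M"] c_pos M_nonneg by (simp add: m_def)

lemma spectral_error_bound: "s k + 3 * m k \<le> 1 / 3"
proof (induction k)
  case 0
  then show ?case
    using initial_bound m0_le m_nonneg[of 0] by linarith
next
  case (Suc k)
  then show ?case
    using s_Suc[of k] m_halving_if[OF halving_if] by fastforce
qed

lemma r_halving: "r (Suc k) \<le> r k / 2"
  by (rule halving_if[OF spectral_error_bound])

lemma m_halving: "m (Suc k) \<le> m k / 2"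
  by (rule m_halving_if[OF r_halving])

lemma m_le_m0: "m k \<le> m 0"
proof (induction k)
  case (Suc k)
  then show ?case using m_halving[of k] m_nonneg[of k] by linarith
qed simp

subsection \<open>All columns are accurate after \<open>n\<close> steps\<close>

text \<open>A replaced column is exact at that moment and afterwards drifts only with the Jacobian, by
  \<open>m k + m (Suc k)\<close> per step; these drifts telescope to \<open>3 * (m 0 - m k)\<close> because \<open>m\<close> halves. So
  a step either adds a new accurate column, or it picks a column that was already accurate; as it
  picks the worst one, all columns are then accurate. The initial error of \<open>B\<close>, whose scaled
  Frobenius norm may be as large as \<open>sqrt n / 3\<close>, is thereby forgotten.\<close>

lemma accurate_columns:
  "\<exists>S. min k CARD('n) \<le> card S \<and> (\<forall>j\<in>S. c * norm (column j (E k)) \<le> 3 * (m 0 - m k))"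
proof (induction k)
  case 0
  show ?case by (intro exI[of _ "{}"]) simp
next
  case (Suc k)
  then obtain S where S: "min k CARD('n) \<le> card S"
    and acc: "\<And>j. j \<in> S \<Longrightarrow> c * norm (column j (E k)) \<le> 3 * (m 0 - m k)"
    by blast
  define D where "D = B k - J (x (Suc k))"
  obtain i where zero: "\<And>j. column j (E (Suc k)) = (if j = i then 0 else column j D)"
    and largest: "\<And>j. norm (column j D) \<le> norm (column i D)"
    by (rule error_columns[of k, folded D_def]) (rule that)
  have drift: "c * norm (column j D) \<le> 3 * (m 0 - m (Suc k))" if "j \<in> S" for j
  proof -
    have col: "column j D = column j (E k) + column j (J (x k) - J (x (Suc k)))"
      unfolding D_def old_error_split by (rule column_add)
    have "norm (column j D)
        \<le> norm (column j (E k)) + spectral_norm (J (x k) - J (x (Suc k)))"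
      using norm_triangle_ineq[of "column j (E k)" "column j (J (x k) - J (x (Suc k)))"]
        norm_column_le_spectral[of j "J (x k) - J (x (Suc k))"]
      unfolding col by linarith
    then have "c * norm (column j D)
        \<le> c * norm (column j (E k)) + c * spectral_norm (J (x k) - J (x (Suc k)))"
      using c_pos by (simp flip: distrib_left)
    then show ?thesis
      using add_mono[OF acc[OF that] jacobian_change[of k]] m_halving[of k] by argo
  qed
  have nonneg: "0 \<le> 3 * (m 0 - m (Suc k))"
    using m_le_m0[of "Suc k"] by simp
  show ?case
  proof (cases "i \<in> S")
    case True
    have "c * norm (column j D) \<le> 3 * (m 0 - m (Suc k))" for j
      using drift[OF True] mult_left_mono[OF largest[of j], of c] c_pos by linarith
    then show ?thesis
      using nonneg by (intro exI[of _ UNIV]) (simp add: zero)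
  next
    case False
    then have "card (insert i S) = Suc (card S)"
      by simp
    then show ?thesis
      using S drift nonneg by (intro exI[of _ "insert i S"]) (auto simp: zero)
  qed
qed

lemma t_after_n_steps: "t CARD('n) \<le> 3 * (sqrt (real CARD('n)) * m 0)"
proof -
  let ?n = "CARD('n)"
  obtain S where card: "?n \<le> card S"
    and acc: "\<And>j::'n. j \<in> S \<Longrightarrow> c * norm (column j (E ?n)) \<le> 3 * (m 0 - m ?n)"
    using accurate_columns[of ?n] by auto
  have "S = UNIV"
    using card by (intro card_seteq) auto
  then have "norm (column j (E ?n)) \<le> 3 * m 0 / c" for j
    using acc[of j] m_nonneg[of ?n] c_pos by (simp add: field_simps)
  then have "norm (E ?n) \<le> sqrt (real CARD('n)) * (3 * m 0 / c)"
    using c_pos m_nonneg[of 0] by (intro frobenius_le_columns) auto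
  then show ?thesis
    using c_pos by (simp add: t_def field_simps)
qed

subsection \<open>Superlinear convergence\<close>

text \<open>The weight \<open>6\<close> lets the halving of \<open>m\<close> pay for the drift of the Jacobian at every
  contraction rate \<open>\<rho> \<ge> 2 / 3\<close>.\<close>

lemma lyapunov_Suc:
  "t (Suc k) + 6 * (sqrt (real CARD('n)) * m (Suc k)) \<le> rho * (t k + 6 * (sqrt (real CARD('n)) * m k))"
proof -
  define w where "w = sqrt (real CARD('n)) * m k"
  define w' where "w' = sqrt (real CARD('n)) * m (Suc k)"
  have w: "0 \<le> w" "w' \<le> w / 2"
    using m_nonneg[of k] mult_left_mono[OF m_halving[of k], of "sqrt (real CARD('n))"]
    by (simp_all add: w_def w'_def)
  have "t (Suc k) \<le> rho * (t k + (w + w'))"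
    using t_Suc[of k] by (simp add: w_def w'_def distrib_left)
  also have "\<dots> \<le> rho * (t k + 3 / 2 * w)"
    using w rho_bounds(1) by (intro mult_left_mono) auto
  finally have "t (Suc k) \<le> rho * t k + 3 / 2 * (rho * w)"
    by (simp add: algebra_simps)
  moreover have "2 / 3 * w \<le> rho * w"
    using rho_bounds(1) w by (intro mult_right_mono)
  ultimately have "t (Suc k) + 6 * w' \<le> rho * t k + 6 * (rho * w)"
    using w by linarith
  then show ?thesis
    by (simp add: w_def w'_def distrib_left mult.left_commute)
qed

lemma lyapunov_bound:
  assumes "CARD('n) \<le> k"
  shows "t k + 6 * (sqrt (real CARD('n)) * m k) \<le> rho ^ k / 4"
  using assms
proof (induction k rule: dec_induct)
  case base
  have "sqrt (real CARD('n)) * m CARD('n) \<le> sqrt (real CARD('n)) * m 0"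
    by (intro mult_left_mono m_le_m0) simp
  \<comment> \<open>\<open>3 + 6\<close> times \<open>sqrt n * m 0 \<le> 1 / 144\<close>\<close>
  then have "t CARD('n) + 6 * (sqrt (real CARD('n)) * m CARD('n)) \<le> 1 / 16"
    using t_after_n_steps initial_bound s_nonneg[of 0] by linarith
  also have "\<dots> \<le> rho ^ CARD('n) / 4"
    using sqrt_contraction_power_ge[OF dim, folded rho_def] by simp
  finally show ?case .
next
  case (step k)
  have "rho * (t k + 6 * (sqrt (real CARD('n)) * m k)) \<le> rho * (rho ^ k / 4)"
    using step.IH rho_bounds(1) by (intro mult_left_mono) auto
  then show ?case
    using lyapunov_Suc[of k] by simp
qed

text \<open>The factor \<open>e\<close> is what makes the first \<open>n\<close> steps harmless: there halving suffices, because
  \<open>1 / 2 \<le> e * \<rho> ^ n\<close>.\<close>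

lemma r_Suc_le: "r (Suc k) \<le> exp 1 * rho ^ k * r k"
proof (cases "CARD('n) \<le> k")
  case True
  have "m k \<le> sqrt (real CARD('n)) * m k"
    using mult_right_mono[OF sqrt_n_ge_1 m_nonneg[of k]] by simp
  then have sm: "s k + 2 * m k \<le> rho ^ k / 4"
    using lyapunov_bound[OF True] s_le_t[of k] m_nonneg[of k] by linarith
  have "2 / 3 * r (Suc k) \<le> (1 - s k - m k) * r (Suc k)"
    using spectral_error_bound[of k] m_nonneg[of k]
    by (intro mult_right_mono r_nonneg) linarith
  also have "\<dots> \<le> (s k + 2 * m k) * r k"
    by (rule r_Suc)
  also have "\<dots> \<le> rho ^ k / 4 * r k"
    using sm by (rule mult_right_mono) (rule r_nonneg)
  finally have "r (Suc k) \<le> 3 / 8 * (rho ^ k * r k)"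
    by simp
  also have "\<dots> \<le> exp 1 * (rho ^ k * r k)"
    using exp_ge_add_one_self[of 1] rho_bounds(1) r_nonneg[of k]
    by (intro mult_right_mono mult_nonneg_nonneg zero_le_power) linarith+
  finally show ?thesis by (simp add: mult.assoc)
next
  case False
  have "1 / 4 \<le> rho ^ CARD('n)"
    by (rule sqrt_contraction_power_ge[OF dim, folded rho_def])
  also have "\<dots> \<le> rho ^ k"
    using False rho_bounds by (intro power_decreasing) auto
  finally have "2 * (1 / 4) \<le> exp 1 * rho ^ k"
    using exp_ge_add_one_self[of 1] by (intro mult_mono) auto
  then have "1 / 2 * r k \<le> exp 1 * rho ^ k * r k"
    by (intro mult_right_mono r_nonneg) simp
  then show ?thesis
    using r_halving[of k] by linarith
qed

lemma rho_power: "rho ^ k = (1 - 1 / real CARD('n)) powr (real k / 2)"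
proof -
  have "0 < 1 - 1 / real CARD('n)"
    using dim by simp
  then show ?thesis
    by (simp add: rho_def powr_half_sqrt[symmetric] powr_realpow[symmetric] powr_powr)
qed

lemma r_superlinear:
  "r k \<le> exp 1 ^ k * (1 - 1 / real CARD('n)) powr (real k * (real k - 1) / 4) * r 0"
proof (induction k)
  case 0
  show ?case using dim by simp
next
  case (Suc k)
  let ?q = "1 - 1 / real CARD('n)"
  have exponent: "real k / 2 + real k * (real k - 1) / 4 = real (Suc k) * (real (Suc k) - 1) / 4"
    by (simp add: field_simps)
  have "r (Suc k) \<le> exp 1 * rho ^ k * r k"
    by (rule r_Suc_le)
  also have "\<dots> \<le> exp 1 * rho ^ k * (exp 1 ^ k * ?q powr (real k * (real k - 1) / 4) * r 0)"
    using rho_bounds(1) by (intro mult_left_mono Suc) auto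
  also have "\<dots> = exp 1 ^ Suc k * (?q powr (real k / 2) * ?q powr (real k * (real k - 1) / 4)) * r 0"
    by (simp add: rho_power mult_ac)
  also have "\<dots> = exp 1 ^ Suc k * ?q powr (real (Suc k) * (real (Suc k) - 1) / 4) * r 0"
    by (simp only: powr_add[symmetric] exponent)
  finally show ?case .
qed

text \<open>The Lyapunov function dominates the error against \<open>J xstar\<close> as well: the Frobenius norm of
  \<open>J (x k) - J xstar\<close> is at most \<open>sqrt n\<close> times the spectral one.\<close>

lemma matrix_error_bound:
  assumes "CARD('n) \<le> k"
  shows "frobenius_norm (B k - J xstar)
    \<le> 2 * inverse c * exp 1 * (1 - 1 / real CARD('n)) powr (real k / 2)"
proof -
  have "norm (B k - J xstar) \<le> norm (E k) + norm (J (x k) - J xstar)"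
    unfolding star_error_split by (rule norm_triangle_ineq)
  also have "\<dots> \<le> norm (E k) + sqrt (real CARD('n)) * spectral_norm (J (x k) - J xstar)"
    by (intro add_left_mono frobenius_le_spectral)
  finally have "c * norm (B k - J xstar)
      \<le> c * (norm (E k) + sqrt (real CARD('n)) * spectral_norm (J (x k) - J xstar))"
    using c_pos by simp
  also have "\<dots> = t k + sqrt (real CARD('n)) * (c * spectral_norm (J (x k) - J xstar))"
    by (simp add: t_def distrib_left mult.left_commute)
  also have "\<dots> \<le> t k + sqrt (real CARD('n)) * m k"
    by (intro add_left_mono mult_left_mono jacobian_error) simp
  also have "\<dots> \<le> 1 / 4 * rho ^ k"
  proof -
    have "0 \<le> sqrt (real CARD('n)) * m k"
      by (intro mult_nonneg_nonneg m_nonneg) simp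
    then show ?thesis
      using lyapunov_bound[OF assms] by linarith
  qed
  also have "\<dots> \<le> 2 * exp 1 * rho ^ k"
    using exp_ge_add_one_self[of 1] rho_bounds(1) by (intro mult_right_mono) auto
  finally show ?thesis
    using c_pos by (simp add: frobenius_norm_eq_norm rho_power field_simps)
qed

end

theorem theorem4p4:
  fixes F :: "real^'n \<Rightarrow> real^'n"
    and J :: "real^'n \<Rightarrow> real^'n^'n"
    and xstar :: "real^'n"
    and M c :: real
    and x u :: "nat \<Rightarrow> real^'n"
    and B :: "nat \<Rightarrow> real^'n^'n"
  assumes "CARD('n) \<ge> 2"
    and "\<And>y. (F has_derivative (\<lambda>h. J y *v h)) (at y)"
    and "F xstar = 0"
    and "M \<ge> 0"
    and "\<And>y. spectral_norm (J y - J xstar) \<le> M * norm (y - xstar)"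
    and "invertible (J xstar)"
    and "c = spectral_norm (matrix_inv (J xstar))"
    and "greedy_broyden F J x B u"
    and "\<And>k. invertible (B k)"
    and "48 * sqrt (real CARD('n)) * c * M * norm (x 0 - xstar)
           + c * spectral_norm (B 0 - J (x 0)) \<le> 1 / 3"
  shows "(\<forall>k\<ge>1. norm (x k - xstar)
            \<le> exp 1 ^ k * (1 - 1 / real CARD('n)) powr (real k * (real k - 1) / 4)
                * norm (x 0 - xstar))
       \<and> (\<forall>k\<ge>4 * CARD('n) + 3. frobenius_norm (B k - J xstar)
            \<le> 2 * inverse c * exp 1 * (1 - 1 / real CARD('n)) powr (real k / 2))"
proof -
  interpret greedy_broyden_run F J xstar M c x u B "sqrt (1 - 1 / real CARD('n))"
    by unfold_locales (fact refl assms)+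
  show ?thesis
    using r_superlinear matrix_error_bound by (auto simp: r_def)
qed

end
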